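(* Let $0<q<1$, let $k\ge0$ be an integer, and let $x,y,a,t$ be complex numbers with $x\neq0$ and $|xt|<1$. Then $$\sum_{n=0}^\infty p_{n+k}(x,y,a)\frac{t^n}{(q;q)_n}=\frac{x^k}{(xt;q)_\infty}\sum_{n=0}^\infty\frac{(-1)^nq^{\binom n2}(a;q)_n(ty)^n}{(q;q)_n}\;{}_3\Phi_2\left(\begin{array}{c}q^{-k},\,aq^n,\,xt\\0,\,0\end{array}\Big|\,q;\frac yx q^{n+k}\right).$$
   Context: For complex $c$: $(c;q)_0=1$, $(c;q)_n=\prod_{i=0}^{n-1}(1-cq^i)$, $(c;q)_\infty=\prod_{i=0}^\infty(1-cq^i)$, and $(c_1,\dots,c_r;q)_n=(c_1;q)_n\cdots(c_r;q)_n$. The $q$-binomial coefficient is $\left[{n\atop k}\right]_q=\dfrac{(q;q)_n}{(q;q)_k(q;q)_{n-k}}$. The generalized Cauchy polynomials are $$p_n(x,y,a)=\sum_{k=0}^n\left[{n\atop k}\right]_q(-1)^kq^{\binom k2}(a;q)_k\,x^{n-k}y^k.$$ The series ${}_3\Phi_2$ is $${}_3\Phi_2\left(\begin{array}{c}a_1,a_2,a_3\\ b_1,b_2\end{array}\Big|\,q;z\right)=\sum_{n=0}^\infty\frac{(a_1,a_2,a_3;q)_n}{(b_1,b_2;q)_n}\frac{z^n}{(q;q)_n}$$ (here it terminates because of the parameter $q^{-k}$). *)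

theory Defs
  imports "HOL-Analysis.Analysis"
begin

definition qpoch :: "complex \<Rightarrow> complex \<Rightarrow> nat \<Rightarrow> complex" where
  "qpoch c q n = (\<Prod>i<n. 1 - c * q ^ i)"

text \<open>The infinite product converges whenever \<open>norm q < 1\<close>, also when some factor vanishes;
  the value is unspecified when the product does not converge.\<close>

definition qpoch_inf :: "complex \<Rightarrow> complex \<Rightarrow> complex" where
  "qpoch_inf c q = (\<Prod>i. 1 - c * q ^ i)"

text \<open>Only meaningful for \<open>k \<le> n\<close> (natural subtraction truncates) and \<open>q\<close> not a root of unity.\<close>

definition qbinom :: "complex \<Rightarrow> nat \<Rightarrow> nat \<Rightarrow> complex" where
  "qbinom q n k = qpoch q q n / (qpoch q q k * qpoch q q (n - k))"

definition gen_cauchy_poly :: "complex \<Rightarrow> nat \<Rightarrow> complex \<Rightarrow> complex \<Rightarrow> complex \<Rightarrow> complex" where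
  "gen_cauchy_poly q n x y a =
     (\<Sum>k\<le>n. qbinom q n k * (-1) ^ k * q ^ (k choose 2) * qpoch a q k * x ^ (n - k) * y ^ k)"

definition Phi32 ::
  "complex \<Rightarrow> complex \<Rightarrow> complex \<Rightarrow> complex \<Rightarrow> complex \<Rightarrow> complex \<Rightarrow> complex \<Rightarrow> complex" where
  "Phi32 a1 a2 a3 b1 b2 q z =
     (\<Sum>n. (qpoch a1 q n * qpoch a2 q n * qpoch a3 q n) / (qpoch b1 q n * qpoch b2 q n)
           * (z ^ n / qpoch q q n))"

end

theory Submission
  imports Defs
begin

text \<open>
  The identity is a Cauchy product in disguise. The \<open>q\<close>-Vandermonde identity
  \[ \left[{n+k\atop j}\right]_q = \sum_{m+i=j} \left[{k\atop m}\right]_q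
       \left[{n\atop i}\right]_q q^{m(n-i)} \]
  splits the coefficient of every term of \<open>p\<^bsub>n+k\<^esub>\<close>; after division by \<open>(q;q)\<^sub>n\<close> the factor
  \<open>[n, i]\<close> becomes \<open>1 / ((q;q)\<^sub>i (q;q)\<^bsub>n-i\<^esub>)\<close>. Hence the \<open>n\<close>-th term on the left is a sum over the
  finitely many \<open>m \<le> k\<close> of \<open>n\<close>-th convolutions of the two sequences
  \[ A_m(i) = (-1)^i q^{\binom i2} q^{im} (a;q)_{i+m} \frac{(ty)^i}{(q;q)_i}, \qquad
     B_m(l) = \frac{(xtq^m)^l}{(q;q)_l} \]
  (lemma \<open>gen_cauchy_poly_add\<close>). Both are absolutely summable, so the left-hand side is
  \<open>\<Sum>m\<le>k\<close> of a constant times \<open>(\<Sum>A\<^sub>m) (\<Sum>B\<^sub>m)\<close>. By Euler's expansion, in the form of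
  \<open>qexp_shift\<close> and \<open>qexp_eq_inverse_qpoch_inf\<close>, the sum of \<open>B\<^sub>m\<close> is
  \<open>1 / (xtq\<^sup>m;q)\<^sub>\<infinity> = (xt;q)\<^sub>m / (xt;q)\<^sub>\<infinity>\<close>; this produces the parameter \<open>xt\<close> of the
  hypergeometric series.

  On the right the hypergeometric series stops at \<open>m = k\<close>, the factor \<open>(q\<^sup>-\<^sup>k;q)\<^sub>m\<close> turns into
  the binomial \<open>[k, m]\<close>, and \<open>(a;q)\<^sub>n (aq\<^sup>n;q)\<^sub>m = (a;q)\<^bsub>n+m\<^esub>\<close>; so its \<open>n\<close>-th term is the
  combination of the numbers \<open>A\<^sub>m(n)\<close> with the same constants (lemma \<open>Phi32_terminating\<close>).
  Interchanging the finite sum over \<open>m\<close> with the series over \<open>n\<close> finishes the proof.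
\<close>

section \<open>Finite identities for q-shifted factorials\<close>

lemma qpoch_0 [simp]: "qpoch c q 0 = 1"
  by (simp add: qpoch_def)

lemma qpoch_Suc: "qpoch c q (Suc n) = qpoch c q n * (1 - c * q ^ n)"
  by (simp add: qpoch_def)

lemma qpoch_zero [simp]: "qpoch 0 q n = 1"
  by (simp add: qpoch_def)

lemma qpoch_add: "qpoch c q (n + m) = qpoch c q n * qpoch (c * q ^ n) q m"
  by (induction m) (simp_all add: qpoch_Suc power_add mult.assoc)

lemma one_minus_power_nonzero:
  fixes q :: complex
  assumes "norm q < 1"
  shows "1 - q ^ Suc n \<noteq> 0"
proof
  assume "1 - q ^ Suc n = 0"
  then have "norm (q ^ Suc n) = 1" by (metis eq_iff_diff_eq_0 norm_one)
  moreover have "norm q * norm q ^ n \<le> norm q"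
    using assms by (intro mult_left_le power_le_one) auto
  ultimately show False using assms by (simp add: norm_mult norm_power)
qed

lemma qpoch_self_nonzero:
  assumes "norm q < 1"
  shows "qpoch q q n \<noteq> 0"
  using one_minus_power_nonzero[OF assms]
  by (induction n) (simp_all add: qpoch_Suc)

lemma choose_two_add: "((m + n) choose 2) = (m choose 2) + (n choose 2) + m * n"
  by (induction n) (simp_all add: numeral_2_eq_2)

text \<open>Reversing the product: multiplied by \<open>q\<^sup>k\<close>, the factor \<open>1 - q\<^bsup>i-k\<^esup>\<close> becomes
  \<open>-q\<^sup>i (1 - q\<^bsup>k-i\<^esup>)\<close>. The powers \<open>q\<^sup>i\<close> collect to \<open>q\<close> to the power \<open>m choose 2\<close>, and the
  remaining factors are the top \<open>m\<close> factors of \<open>(q;q)\<^sub>k\<close>.\<close>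

lemma qpoch_negative_power:
  assumes "q \<noteq> 0" "norm q < 1" "m \<le> k"
  shows "qpoch (q powi (- int k)) q m * q ^ (k * m)
       = (-1) ^ m * q ^ (m choose 2) * (qpoch q q k / qpoch q q (k - m))"
  using assms(3)
proof (induction m)
  case 0
  then show ?case using qpoch_self_nonzero[OF assms(2)] by (simp add: numeral_2_eq_2)
next
  case (Suc m)
  obtain d where d: "k = Suc m + d" using Suc.prems le_iff_add by blast
  have inv: "q powi (- int k) * q ^ k = 1"
    using assms(1) by (simp add: power_int_minus)
  have factor: "(1 - q powi (- int k) * q ^ m) * q ^ k = - (q ^ m * (1 - q ^ Suc d))"
  proof -
    have "(1 - q powi (- int k) * q ^ m) * q ^ k = q ^ k - (q powi (- int k) * q ^ k) * q ^ m"
      by (simp add: algebra_simps)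
    also have "\<dots> = - (q ^ m * (1 - q ^ Suc d))"
      unfolding inv by (simp add: d algebra_simps power_add)
    finally show ?thesis .
  qed
  have "qpoch (q powi (- int k)) q (Suc m) * q ^ (k * Suc m)
      = (qpoch (q powi (- int k)) q m * q ^ (k * m)) * ((1 - q powi (- int k) * q ^ m) * q ^ k)"
    by (simp only: qpoch_Suc mult_Suc_right power_add mult_ac)
  also have "\<dots> = (-1) ^ m * q ^ (m choose 2) * (qpoch q q k / qpoch q q (Suc d))
                * (- (q ^ m * (1 - q ^ Suc d)))"
    using Suc factor d by simp
  also have "\<dots> = (-1) ^ Suc m * q ^ (Suc m choose 2) * (qpoch q q k / qpoch q q d)"
    using one_minus_power_nonzero[OF assms(2), of d] qpoch_self_nonzero[OF assms(2), of d]
    by (simp add: qpoch_Suc[of _ _ d] numeral_2_eq_2 power_add divide_simps)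
  finally show ?case using d by simp
qed

lemma qbinom_0 [simp]: "norm q < 1 \<Longrightarrow> qbinom q n 0 = 1"
  using qpoch_self_nonzero by (simp add: qbinom_def)

lemma qbinom_self [simp]: "norm q < 1 \<Longrightarrow> qbinom q n n = 1"
  using qpoch_self_nonzero by (simp add: qbinom_def)

text \<open>Of the two \<open>q\<close>-Pascal rules, this one carries the power \<open>q\<^bsup>n-j\<^esup>\<close> on the lower neighbour.
  The case \<open>j = n\<close> is excluded because \<^const>\<open>qbinom\<close> does not vanish above the diagonal.\<close>

lemma qbinom_Suc_Suc:
  assumes "norm q < 1" "j < n"
  shows "qbinom q (Suc n) (Suc j) = qbinom q n (Suc j) + q ^ (n - j) * qbinom q n j"
proof -
  obtain d where d: "n = Suc j + d" using assms(2) less_iff_Suc_add by auto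
  have nz: "qpoch q q j \<noteq> 0" "qpoch q q d \<noteq> 0" "1 - q * q ^ j \<noteq> 0" "1 - q * q ^ d \<noteq> 0"
    using qpoch_self_nonzero[OF assms(1)] one_minus_power_nonzero[OF assms(1)] by auto
  have algebra: "f * (v + w * u) / (p * u * (e * v)) = f / (p * u * e) + w * (f / (p * (e * v)))"
    if "p \<noteq> 0" "e \<noteq> 0" "u \<noteq> 0" "v \<noteq> 0" for f p e u v w :: complex
    using that by (simp add: divide_simps) (simp add: algebra_simps)
  have "qbinom q (Suc n) (Suc j)
      = qpoch q q n * (1 - q * q ^ n) / (qpoch q q j * (1 - q * q ^ j) * (qpoch q q d * (1 - q * q ^ d)))"
    by (simp add: qbinom_def d qpoch_Suc)
  also have "1 - q * q ^ n = (1 - q * q ^ d) + q ^ Suc d * (1 - q * q ^ j)"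
    by (simp add: d power_add algebra_simps)
  also note algebra[OF nz]
  also have "qpoch q q n / (qpoch q q j * (1 - q * q ^ j) * qpoch q q d) = qbinom q n (Suc j)"
    by (simp add: qbinom_def d qpoch_Suc)
  also have "qpoch q q n / (qpoch q q j * (qpoch q q d * (1 - q * q ^ d))) = qbinom q n j"
    by (simp add: qbinom_def d qpoch_Suc)
  also have "Suc d = n - j" by (simp add: d)
  finally show ?thesis .
qed

text \<open>Pascal's rule tested against an arbitrary weight. Summing over the whole row hides the
  boundary cases, and the free weight can absorb powers of \<open>q\<close> in an induction.\<close>

lemma qbinom_sum_Suc:
  assumes "norm q < 1"
  shows "(\<Sum>j\<le>Suc n. qbinom q (Suc n) j * w j)
       = (\<Sum>j\<le>n. qbinom q n j * w j) + (\<Sum>j\<le>n. qbinom q n j * (q ^ (n - j) * w (Suc j)))"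
proof -
  have split_last: "(\<Sum>j\<le>n. h j) = (\<Sum>j<n. h j) + h n" for h :: "nat \<Rightarrow> complex"
    by (simp add: lessThan_Suc_atMost[symmetric])
  have "(\<Sum>j\<le>Suc n. qbinom q (Suc n) j * w j)
      = w 0 + ((\<Sum>j<n. qbinom q (Suc n) (Suc j) * w (Suc j)) + w (Suc n))"
    using assms
    by (simp only: sum.atMost_Suc_shift split_last qbinom_0 qbinom_self mult_1_left)
  also have "(\<Sum>j<n. qbinom q (Suc n) (Suc j) * w (Suc j))
      = (\<Sum>j<n. qbinom q n (Suc j) * w (Suc j)) + (\<Sum>j<n. qbinom q n j * (q ^ (n - j) * w (Suc j)))"
    unfolding sum.distrib[symmetric]
    by (intro sum.cong) (simp_all add: qbinom_Suc_Suc[OF assms] algebra_simps)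
  also have "w 0 + (\<dots> + w (Suc n))
      = (w 0 + (\<Sum>j<n. qbinom q n (Suc j) * w (Suc j)))
        + ((\<Sum>j<n. qbinom q n j * (q ^ (n - j) * w (Suc j))) + w (Suc n))"
    by (simp add: add_ac)
  also have "w 0 + (\<Sum>j<n. qbinom q n (Suc j) * w (Suc j)) = (\<Sum>j\<le>n. qbinom q n j * w j)"
    using assms by (simp add: sum.atMost_shift)
  also have "(\<Sum>j<n. qbinom q n j * (q ^ (n - j) * w (Suc j))) + w (Suc n)
      = (\<Sum>j\<le>n. qbinom q n j * (q ^ (n - j) * w (Suc j)))"
    using assms by (simp add: split_last)
  finally show ?thesis .
qed

text \<open>The \<open>q\<close>-Vandermonde identity in weighted form: taking for \<open>w\<close> the indicator of a single
  index gives the classical identity. It follows by induction on \<open>k\<close> for all weights at once: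
  peel one row off \<open>n + Suc k\<close>, apply the hypothesis to \<open>w\<close> and to
  \<open>\<lambda>j. q\<^bsup>n+k-j\<^esup> w (Suc j)\<close>, and recognise Pascal's rule for row \<open>Suc k\<close>. This works because
  \<open>m (n - i) + (n + k - m - i) = (k - m) + (m + 1) (n - i)\<close>.\<close>

lemma qbinom_sum_Vandermonde:
  assumes "norm q < 1"
  shows "(\<Sum>j\<le>n + k. qbinom q (n + k) j * w j)
       = (\<Sum>m\<le>k. qbinom q k m * (\<Sum>i\<le>n. qbinom q n i * (q ^ (m * (n - i)) * w (m + i))))"
proof (induction k arbitrary: w)
  case 0
  then show ?case using assms by simp
next
  case (Suc k)
  have "(\<Sum>j\<le>n + Suc k. qbinom q (n + Suc k) j * w j)
      = (\<Sum>j\<le>n + k. qbinom q (n + k) j * w j)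
        + (\<Sum>j\<le>n + k. qbinom q (n + k) j * (q ^ (n + k - j) * w (Suc j)))"
    using qbinom_sum_Suc[OF assms, of "n + k" w] by simp
  also have "(\<Sum>j\<le>n + k. qbinom q (n + k) j * (q ^ (n + k - j) * w (Suc j)))
      = (\<Sum>m\<le>k. qbinom q k m * (\<Sum>i\<le>n. qbinom q n i *
          (q ^ (m * (n - i)) * (q ^ (n + k - (m + i)) * w (Suc (m + i))))))"
    by (rule Suc.IH)
  also have "\<dots> = (\<Sum>m\<le>k. qbinom q k m * (q ^ (k - m) *
       (\<Sum>i\<le>n. qbinom q n i * (q ^ (Suc m * (n - i)) * w (Suc m + i)))))"
  proof (intro sum.cong refl arg_cong[where f = "\<lambda>s. qbinom q k _ * s"])
    fix m assume m: "m \<in> {..k}"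
    have "qbinom q n i * (q ^ (m * (n - i)) * (q ^ (n + k - (m + i)) * w (Suc (m + i))))
        = q ^ (k - m) * (qbinom q n i * (q ^ (Suc m * (n - i)) * w (Suc m + i)))"
      if "i \<le> n" for i
    proof -
      have "m * (n - i) + (n + k - (m + i)) = (k - m) + Suc m * (n - i)"
        using m that by simp
      then have "q ^ (m * (n - i)) * q ^ (n + k - (m + i)) = q ^ (k - m) * q ^ (Suc m * (n - i))"
        by (simp only: power_add[symmetric])
      then have "q ^ (m * (n - i)) * q ^ (n + k - (m + i)) * (qbinom q n i * w (Suc m + i))
          = q ^ (k - m) * q ^ (Suc m * (n - i)) * (qbinom q n i * w (Suc m + i))"
        by (rule arg_cong)
      then show ?thesis by (simp only: mult_ac add_Suc)
    qed
    then show "(\<Sum>i\<le>n. qbinom q n i * (q ^ (m * (n - i)) * (q ^ (n + k - (m + i)) * w (Suc (m + i)))))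
        = q ^ (k - m) * (\<Sum>i\<le>n. qbinom q n i * (q ^ (Suc m * (n - i)) * w (Suc m + i)))"
      unfolding sum_distrib_left
      by (intro sum.cong refl) simp
  qed
  also have "(\<Sum>j\<le>n + k. qbinom q (n + k) j * w j)
      = (\<Sum>m\<le>k. qbinom q k m * (\<Sum>i\<le>n. qbinom q n i * (q ^ (m * (n - i)) * w (m + i))))"
    by (rule Suc.IH)
  finally show ?case
    using qbinom_sum_Suc[OF assms, of k "\<lambda>m. \<Sum>i\<le>n. qbinom q n i * (q ^ (m * (n - i)) * w (m + i))"]
    by simp
qed

section \<open>Absolutely convergent series with a limiting ratio\<close>

lemma summable_norm_if_ratio_tendsto:
  fixes f r :: "nat \<Rightarrow> complex"
  assumes rec: "\<And>n. f (Suc n) = r n * f n" and lim: "r \<longlonglongrightarrow> l" and "norm l < 1"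
  shows "summable (\<lambda>n. norm (f n))"
proof -
  obtain c where c: "norm l < c" "c < 1" using dense[OF assms(3)] by blast
  have "(\<lambda>n. norm (r n)) \<longlonglongrightarrow> norm l" using lim by (rule tendsto_norm)
  then have "eventually (\<lambda>n. norm (r n) < c) sequentially"
    using c(1) by (rule order_tendstoD)
  then obtain N where N: "\<And>n. n \<ge> N \<Longrightarrow> norm (r n) < c"
    by (auto simp: eventually_sequentially)
  show ?thesis
  proof (rule summable_ratio_test[of c N])
    show "c < 1" by (fact c(2))
    fix n assume "n \<ge> N"
    then show "norm (norm (f (Suc n))) \<le> c * norm (norm (f n))"
      using N[of n] by (simp add: rec norm_mult mult_right_mono)
  qed
qed

lemma one_minus_power_Suc_tendsto:
  fixes q :: complex
  assumes "norm q < 1"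
  shows "(\<lambda>n. 1 - q ^ Suc n) \<longlonglongrightarrow> 1"
  using tendsto_diff[OF tendsto_const LIMSEQ_Suc[OF LIMSEQ_power_zero[OF assms]], of 1] by simp

lemma summable_norm_qexp:
  assumes "norm q < 1" "norm z < 1"
  shows "summable (\<lambda>n. norm (z ^ n / qpoch q q n))"
proof (rule summable_norm_if_ratio_tendsto)
  show "z ^ Suc n / qpoch q q (Suc n) = z / (1 - q ^ Suc n) * (z ^ n / qpoch q q n)" for n
    by (simp add: qpoch_Suc)
  show "(\<lambda>n. z / (1 - q ^ Suc n)) \<longlonglongrightarrow> z"
    using tendsto_divide[OF tendsto_const one_minus_power_Suc_tendsto[OF assms(1)], of z] by simp
qed fact

text \<open>The series is entire in \<open>z\<close>: passing from \<open>n\<close> to \<open>Suc n\<close> raises \<open>n choose 2\<close> by \<open>n\<close>, so the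
  ratio of consecutive terms carries a factor \<open>q\<^sup>n\<close> and tends to \<open>0\<close>.\<close>

lemma summable_norm_shifted_numerator:
  assumes "norm q < 1"
  shows "summable (\<lambda>n. norm ((-1) ^ n * q ^ (n choose 2) * q ^ (n * m) * qpoch a q (n + m) * z ^ n
            / qpoch q q n))"
proof (rule summable_norm_if_ratio_tendsto)
  let ?r = "\<lambda>n. - (q ^ (n + m) * (1 - a * q ^ (n + m)) * z) / (1 - q ^ Suc n)"
  show "(-1) ^ Suc n * q ^ (Suc n choose 2) * q ^ (Suc n * m) * qpoch a q (Suc n + m) * z ^ Suc n
            / qpoch q q (Suc n)
      = ?r n * ((-1) ^ n * q ^ (n choose 2) * q ^ (n * m) * qpoch a q (n + m) * z ^ n / qpoch q q n)"
    for n
    by (simp add: qpoch_Suc numeral_2_eq_2 power_add mult_ac)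
  have "(\<lambda>n. q ^ (n + m)) \<longlonglongrightarrow> 0"
    using LIMSEQ_ignore_initial_segment[OF LIMSEQ_power_zero[OF assms]] .
  then have "?r \<longlonglongrightarrow> - (0 * (1 - a * 0) * z) / 1"
    by (intro tendsto_intros one_minus_power_Suc_tendsto assms) auto
  then show "?r \<longlonglongrightarrow> 0" by simp
qed simp

section \<open>Euler's expansion of the reciprocal infinite product\<close>

text \<open>The series \<open>E(u) = \<Sum>u\<^sup>n / (q;q)\<^sub>n\<close> satisfies \<open>E(u) - E(uq) = u E(u)\<close>, because the
  factor \<open>1 - q\<^sup>n\<close> of the difference cancels the last factor of \<open>(q;q)\<^sub>n\<close>. Iterating
  \<open>E(uq) = (1 - u) E(u)\<close> along \<open>z, zq, zq\<^sup>2, \<dots>\<close> builds up \<open>(z;q)\<^sub>m\<close>.\<close>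

lemma qexp_shift:
  assumes "norm q < 1" "norm z < 1"
  shows "(\<Sum>n. (z * q ^ m) ^ n / qpoch q q n) = (\<Sum>n. z ^ n / qpoch q q n) * qpoch z q m"
proof -
  have step: "(\<Sum>n. (u * q) ^ n / qpoch q q n) = (\<Sum>n. u ^ n / qpoch q q n) * (1 - u)"
    if u: "norm u < 1" for u
  proof -
    let ?f = "\<lambda>n. u ^ n / qpoch q q n" and ?g = "\<lambda>n. (u * q) ^ n / qpoch q q n"
    have "norm u * norm q \<le> norm u" using assms(1) by (intro mult_left_le) auto
    then have uq: "norm (u * q) < 1" using u by (simp add: norm_mult)
    have sf: "summable ?f" and sg: "summable ?g"
      using summable_norm_cancel[OF summable_norm_qexp[OF assms(1)]] u uq by blast+
    have "?f (Suc n) - ?g (Suc n) = u * ?f n" for n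
    proof -
      have "?f (Suc n) - ?g (Suc n) = u * u ^ n * (1 - q * q ^ n) / (qpoch q q n * (1 - q * q ^ n))"
        unfolding diff_divide_distrib[symmetric] qpoch_Suc
        by (simp add: power_mult_distrib algebra_simps)
      then show ?thesis using one_minus_power_nonzero[OF assms(1), of n] by simp
    qed
    moreover have "(\<lambda>n. ?f (Suc n) - ?g (Suc n)) sums ((\<Sum>n. ?f n) - ?f 0 - ((\<Sum>n. ?g n) - ?g 0))"
      using sf sg by (intro sums_diff iffD2[OF sums_Suc_iff[of ?f]] iffD2[OF sums_Suc_iff[of ?g]])
        (simp_all add: summable_sums)
    moreover have "(\<lambda>n. u * ?f n) sums (u * (\<Sum>n. ?f n))"
      using sf by (intro sums_mult summable_sums)
    ultimately have "u * (\<Sum>n. ?f n) = (\<Sum>n. ?f n) - (\<Sum>n. ?g n)"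
      using sums_unique2 by fastforce
    then show ?thesis by (simp add: algebra_simps)
  qed
  show ?thesis
  proof (induction m)
    case (Suc m)
    have "norm z * norm q ^ m \<le> norm z"
      using assms(1) by (intro mult_left_le power_le_one) auto
    then have "norm (z * q ^ m) < 1" using assms(2) by (simp add: norm_mult norm_power)
    have "(\<Sum>n. (z * q ^ Suc m) ^ n / qpoch q q n) = (\<Sum>n. (z * q ^ m * q) ^ n / qpoch q q n)"
      by (simp only: power_Suc mult_ac)
    also have "\<dots> = (\<Sum>n. (z * q ^ m) ^ n / qpoch q q n) * (1 - z * q ^ m)"
      by (rule step) fact
    finally show ?case unfolding Suc.IH qpoch_Suc by (simp only: mult.assoc)
  qed simp
qed

text \<open>Let \<open>m\<close> tend to infinity in \<open>E(zq\<^sup>m) = E(z) (z;q)\<^sub>m\<close>: the left side tends to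
  \<open>E(0) = 1\<close> by continuity of the power series. The resulting equation
  \<open>E(z) (z;q)\<^sub>\<infinity> = 1\<close> shows at the same time that the infinite product is not zero.\<close>

lemma qexp_eq_inverse_qpoch_inf:
  assumes "norm q < 1" "norm z < 1"
  shows "(\<Sum>n. z ^ n / qpoch q q n) = 1 / qpoch_inf z q"
proof -
  let ?E = "\<lambda>z. \<Sum>n. z ^ n / qpoch q q n"
  have "summable (\<lambda>i. norm ((1 - z * q ^ i) - 1))"
    using assms(1) by (simp add: norm_mult norm_power summable_geometric summable_mult)
  then have "convergent_prod (\<lambda>i. 1 - z * q ^ i)"
    by (intro abs_convergent_prod_imp_convergent_prod summable_imp_abs_convergent_prod)
  from convergent_prod_LIMSEQ[OF this]
  have "(\<lambda>n. qpoch z q (Suc n)) \<longlonglongrightarrow> qpoch_inf z q"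
    by (simp add: qpoch_def qpoch_inf_def lessThan_Suc_atMost)
  then have "qpoch z q \<longlonglongrightarrow> qpoch_inf z q" by (rule LIMSEQ_imp_Suc)
  then have prod: "(\<lambda>n. ?E z * qpoch z q n) \<longlonglongrightarrow> ?E z * qpoch_inf z q"
    by (intro tendsto_intros)
  (* Any point of the open unit disc other than 0 gives continuity at 0. *)
  have half: "summable (\<lambda>n. (1 / qpoch q q n) * (1/2) ^ n)"
    using summable_norm_cancel[OF summable_norm_qexp[OF assms(1), of "1/2"]] by simp
  have "isCont (\<lambda>z. \<Sum>n. (1 / qpoch q q n) * z ^ n) 0"
    by (rule isCont_powser[OF half]) simp
  then have cont: "isCont ?E 0" by simp
  have "(\<lambda>n. z * q ^ n) \<longlonglongrightarrow> 0"
    using tendsto_mult_right_zero[OF LIMSEQ_power_zero[OF assms(1)]] .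
  from isCont_tendsto_compose[OF cont this] have "(\<lambda>n. ?E z * qpoch z q n) \<longlonglongrightarrow> ?E 0"
    by (simp add: qexp_shift[OF assms])
  moreover have "?E 0 = 1"
    using powser_zero[of "\<lambda>n. 1 / qpoch q q n"] by simp
  ultimately have "?E z * qpoch_inf z q = 1"
    using LIMSEQ_unique[OF prod] by simp
  then show ?thesis by (auto simp: eq_divide_eq)
qed

section \<open>The two sides of the generating function\<close>

text \<open>The argument \<open>(y/x) q\<^bsup>n+k\<^esup>\<close> is what makes the termwise rewriting possible: its \<open>m\<close>-th power
  contributes \<open>q\<^bsup>km\<^esup>\<close>, which normalises \<open>(q\<^sup>-\<^sup>k;q)\<^sub>m\<close>, and \<open>q\<^bsup>nm\<^esup>\<close>, which goes into \<open>A\<^sub>m(n)\<close>.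
  The factors \<open>(a;q)\<^sub>n\<close> and \<open>x\<^sup>k\<close> of the surrounding formula are included so that
  \<open>(aq\<^sup>n;q)\<^sub>m\<close> and \<open>x\<^bsup>-m\<^esup>\<close> can be absorbed.\<close>

lemma Phi32_terminating:
  assumes "q \<noteq> 0" "norm q < 1" "x \<noteq> 0"
  shows "x ^ k * (qpoch a q n * Phi32 (q powi (- int k)) (a * q ^ n) u 0 0 q (y / x * q ^ (n + k)))
       = (\<Sum>m\<le>k. qbinom q k m * (-1) ^ m * q ^ (m choose 2) * x ^ (k - m) * y ^ m * qpoch u q m
             * (q ^ (n * m) * qpoch a q (n + m)))"
proof -
  let ?P = "\<lambda>m. qpoch (q powi (- int k)) q m * qpoch (a * q ^ n) q m * qpoch u q m
      / (qpoch 0 q m * qpoch 0 q m) * ((y / x * q ^ (n + k)) ^ m / qpoch q q m)"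
  (* For m > k the product (q^(-k);q)_m contains the factor with index k, which is zero. *)
  have vanish: "?P m = 0" if "m \<notin> {..k}" for m
  proof -
    have "k < m" using that by simp
    moreover have "1 - q powi (- int k) * q ^ k = 0"
      using assms(1) by (simp add: power_int_minus)
    ultimately have "qpoch (q powi (- int k)) q m = 0"
      unfolding qpoch_def by (subst prod_zero_iff) auto
    then show ?thesis by simp
  qed
  have "Phi32 (q powi (- int k)) (a * q ^ n) u 0 0 q (y / x * q ^ (n + k)) = (\<Sum>m\<le>k. ?P m)"
    unfolding Phi32_def by (rule suminf_finite) (use vanish in auto)
  moreover have "x ^ k * (qpoch a q n * ?P m)
      = qbinom q k m * (-1) ^ m * q ^ (m choose 2) * x ^ (k - m) * y ^ m * qpoch u q m
             * (q ^ (n * m) * qpoch a q (n + m))" if "m \<le> k" for m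
  proof -
    have x: "x ^ k * (y / x) ^ m = x ^ (k - m) * y ^ m"
      using that assms(3) by (simp add: power_diff power_divide)
    have z: "(y / x * q ^ (n + k)) ^ m = (y / x) ^ m * (q ^ (n * m) * q ^ (k * m))"
      unfolding power_mult_distrib power_mult[symmetric] add_mult_distrib power_add ..
    have "x ^ k * (qpoch a q n * ?P m)
        = (x ^ k * (y / x) ^ m) * (qpoch (q powi (- int k)) q m * q ^ (k * m)) * q ^ (n * m)
          * (qpoch a q n * qpoch (a * q ^ n) q m) * qpoch u q m / qpoch q q m"
      unfolding z by (simp add: mult_ac)
    also have "\<dots> = qbinom q k m * (-1) ^ m * q ^ (m choose 2) * x ^ (k - m) * y ^ m * qpoch u q m
             * (q ^ (n * m) * qpoch a q (n + m))"
      unfolding x qpoch_negative_power[OF assms(1,2) that] qpoch_add[symmetric]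
      by (simp add: qbinom_def mult_ac)
    finally show ?thesis .
  qed
  ultimately show ?thesis by (simp add: sum_distrib_left)
qed

text \<open>In the Vandermonde expansion the exponent of \<open>x\<close> splits as
  \<open>n + k - (m + i) = (k - m) + (n - i)\<close>, the exponent \<open>(m + i) choose 2\<close> splits with the cross term
  \<open>m i\<close>, and \<open>q\<^bsup>m(n-i)\<^esup>\<close> joins \<open>(xt)\<^bsup>n-i\<^esup>\<close>. Thus every summand is a product of a function of
  \<open>m\<close>, one of \<open>(m, i)\<close> and one of \<open>(m, n - i)\<close>: for each \<open>m\<close> a convolution.\<close>

lemma gen_cauchy_poly_add:
  assumes "norm q < 1"
  shows "gen_cauchy_poly q (n + k) x y a * (t ^ n / qpoch q q n)
       = (\<Sum>m\<le>k. qbinom q k m * (-1) ^ m * q ^ (m choose 2) * x ^ (k - m) * y ^ m *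
           (\<Sum>i\<le>n. ((-1) ^ i * q ^ (i choose 2) * q ^ (i * m) * qpoch a q (i + m) * (t * y) ^ i
                        / qpoch q q i)
                   * ((x * t * q ^ m) ^ (n - i) / qpoch q q (n - i))))"
proof -
  define w where "w j = (-1) ^ j * q ^ (j choose 2) * qpoch a q j * x ^ (n + k - j) * y ^ j" for j
  have "gen_cauchy_poly q (n + k) x y a = (\<Sum>j\<le>n + k. qbinom q (n + k) j * w j)"
    by (simp add: gen_cauchy_poly_def w_def mult.assoc)
  also have "\<dots> = (\<Sum>m\<le>k. qbinom q k m * (\<Sum>i\<le>n. qbinom q n i * (q ^ (m * (n - i)) * w (m + i))))"
    by (rule qbinom_sum_Vandermonde[OF assms])
  finally have expand: "gen_cauchy_poly q (n + k) x y a * (t ^ n / qpoch q q n)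
      = (\<Sum>m\<le>k. \<Sum>i\<le>n. qbinom q k m * (qbinom q n i * (q ^ (m * (n - i)) * w (m + i))
          * (t ^ n / qpoch q q n)))"
    by (simp only: sum_distrib_left sum_distrib_right mult.assoc)
  have "qbinom q n i * (q ^ (m * (n - i)) * w (m + i)) * (t ^ n / qpoch q q n)
      = (-1) ^ m * q ^ (m choose 2) * x ^ (k - m) * y ^ m *
        (((-1) ^ i * q ^ (i choose 2) * q ^ (i * m) * qpoch a q (i + m) * (t * y) ^ i / qpoch q q i)
         * ((x * t * q ^ m) ^ (n - i) / qpoch q q (n - i)))"
    if "m \<le> k" "i \<le> n" for m i
  proof -
    have exponent: "n + k - (m + i) = (k - m) + (n - i)" using that by simp
    have tn: "t ^ n = t ^ i * t ^ (n - i)"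
      using that by (simp flip: power_add)
    have xt: "(x * t * q ^ m) ^ (n - i) = x ^ (n - i) * t ^ (n - i) * q ^ (m * (n - i))"
      by (simp add: power_mult_distrib power_mult)
    show ?thesis
      using qpoch_self_nonzero[OF assms, of n]
      unfolding w_def choose_two_add exponent tn xt qbinom_def add.commute[of i m]
      by (simp add: power_add power_mult_distrib mult_ac)
  qed
  then show ?thesis
    unfolding expand sum_distrib_left
    by (intro sum.cong refl) (simp add: mult.assoc)
qed

theorem theorem2p3:
  fixes q :: real and Q :: complex and k :: nat and x y a t :: complex
  assumes "0 < q" and "q < 1"
    and "Q = complex_of_real q"
    and "x \<noteq> 0" and "norm (x * t) < 1"
  shows "summable (\<lambda>n. gen_cauchy_poly Q (n + k) x y a * (t ^ n / qpoch Q Q n)) \<and>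
    summable (\<lambda>n. (-1) ^ n * Q ^ (n choose 2) * qpoch a Q n * (t * y) ^ n / qpoch Q Q n
                 * Phi32 (Q powi (- int k)) (a * Q ^ n) (x * t) 0 0 Q (y / x * Q ^ (n + k))) \<and>
    (\<Sum>n. gen_cauchy_poly Q (n + k) x y a * (t ^ n / qpoch Q Q n)) =
      x ^ k / qpoch_inf (x * t) Q *
      (\<Sum>n. (-1) ^ n * Q ^ (n choose 2) * qpoch a Q n * (t * y) ^ n / qpoch Q Q n
           * Phi32 (Q powi (- int k)) (a * Q ^ n) (x * t) 0 0 Q (y / x * Q ^ (n + k)))"
proof -
  have Q: "Q \<noteq> 0" "norm Q < 1" using assms(1-3) by auto
  define c where "c m = qbinom Q k m * (-1) ^ m * Q ^ (m choose 2) * x ^ (k - m) * y ^ m" for m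
  define A where "A m n = (-1) ^ n * Q ^ (n choose 2) * Q ^ (n * m) * qpoch a Q (n + m) * (t * y) ^ n
      / qpoch Q Q n" for m n
  define B where "B m n = (x * t * Q ^ m) ^ n / qpoch Q Q n" for m n
  define E where "E = 1 / qpoch_inf (x * t) Q"
  define R where "R n = (-1) ^ n * Q ^ (n choose 2) * qpoch a Q n * (t * y) ^ n / qpoch Q Q n
           * Phi32 (Q powi (- int k)) (a * Q ^ n) (x * t) 0 0 Q (y / x * Q ^ (n + k))" for n
  have sumA: "summable (\<lambda>n. norm (A m n))" for m
    unfolding A_def by (rule summable_norm_shifted_numerator[OF Q(2)])
  have sumB: "summable (\<lambda>n. norm (B m n))" for m
  proof -
    have "norm (x * t) * norm Q ^ m \<le> norm (x * t)"
      using Q(2) by (intro mult_left_le power_le_one) auto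
    then have "norm (x * t * Q ^ m) < 1"
      using assms(5) by (simp add: norm_mult norm_power)
    then show ?thesis unfolding B_def by (rule summable_norm_qexp[OF Q(2)])
  qed
  have B: "(\<Sum>n. B m n) = E * qpoch (x * t) Q m" for m
    unfolding B_def E_def qexp_shift[OF Q(2) assms(5)] qexp_eq_inverse_qpoch_inf[OF Q(2) assms(5)] ..
  have left: "gen_cauchy_poly Q (n + k) x y a * (t ^ n / qpoch Q Q n)
      = (\<Sum>m\<le>k. c m * (\<Sum>i\<le>n. A m i * B m (n - i)))" for n
    unfolding c_def A_def B_def by (rule gen_cauchy_poly_add[OF Q(2)])
  have right: "x ^ k * R n = (\<Sum>m\<le>k. c m * qpoch (x * t) Q m * A m n)" for n
  proof -
    have "x ^ k * R n = (-1) ^ n * Q ^ (n choose 2) * (t * y) ^ n / qpoch Q Q n *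
       (x ^ k * (qpoch a Q n * Phi32 (Q powi (- int k)) (a * Q ^ n) (x * t) 0 0 Q (y / x * Q ^ (n + k))))"
      by (simp add: R_def mult_ac)
    then show ?thesis
      unfolding Phi32_terminating[OF Q assms(4)] sum_distrib_left
      by (simp add: c_def A_def mult_ac)
  qed
  (* Both sides reduce to this finite combination: the left-hand series sums to E * S. *)
  define S where "S = (\<Sum>m\<le>k. c m * qpoch (x * t) Q m * (\<Sum>n. A m n))"
  have "(\<lambda>n. \<Sum>m\<le>k. c m * (\<Sum>i\<le>n. A m i * B m (n - i)))
      sums (\<Sum>m\<le>k. c m * ((\<Sum>n. A m n) * (\<Sum>n. B m n)))"
    by (intro sums_sum sums_mult Cauchy_product_sums sumA sumB)
  also have "(\<Sum>m\<le>k. c m * ((\<Sum>n. A m n) * (\<Sum>n. B m n))) = E * S"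
    by (simp add: B S_def sum_distrib_left mult_ac)
  finally have L: "(\<lambda>n. gen_cauchy_poly Q (n + k) x y a * (t ^ n / qpoch Q Q n)) sums (E * S)"
    unfolding left .
  have "(\<lambda>n. \<Sum>m\<le>k. c m * qpoch (x * t) Q m * A m n) sums S"
    unfolding S_def by (intro sums_sum sums_mult summable_sums summable_norm_cancel[OF sumA])
  then have "(\<lambda>n. x ^ k * R n) sums S" unfolding right .
  from sums_mult[OF this, of "inverse (x ^ k)"] have "R sums (S / x ^ k)"
    using assms(4) by (simp add: field_simps)
  then have "summable R" "suminf R = S / x ^ k" by (auto simp: sums_iff)
  moreover have "x ^ k / qpoch_inf (x * t) Q * (S / x ^ k) = E * S"
    using assms(4) by (simp add: E_def)
  ultimately show ?thesis
    using L unfolding R_def[abs_def] by (auto simp: sums_iff)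
qed

end
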